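(* Let $V$ be a vector space of arbitrary dimension over a field $\mathbb{K}$ and let $\mathcal F=\{\langle\cdot,\cdot\rangle_i\}_{i\in I\cup\{0\}}$ be a nondegenerate family of inner products on $V$, where $\langle\cdot,\cdot\rangle_0$ is nondegenerate and every $\langle\cdot,\cdot\rangle_i$ is partially continuous relative to the $\langle\cdot,\cdot\rangle_0$-topology of $V$. Then: (i) For each $i\in I$ there is a linear map $T_i\colon V\to V$ such that $\langle x,y\rangle_i=\langle T_i(x),y\rangle_0$ for all $x,y\in V$. Furthermore, each $T_i$ is a self-adjoint operator of $(V,\langle\cdot,\cdot\rangle_0)$. (ii) With the maps $T_i$ of (i), $\mathcal F$ is simultaneously orthogonalizable if and only if there exists an orthogonal basis $B$ of $(V,\langle\cdot,\cdot\rangle_0)$ such that each $T_i$ ($i\in I$) is diagonalizable relative to $B$, i.e. $T_i(v)\in\mathbb{K}v$ for all $v\in B$ and $i\in I$. (iii) If $\mathrm{char}(\mathbb{K})\neq 2$ and $\dim(V)$ is either finite or countably infinite, then $\mathcal F$ is simultaneously orthogonalizable if and only if the family $\{T_i\}_{i\in I}$ of (i) is simultaneously diagonalizable. (iv) Suppose $\mathrm{char}(\mathbb{K})=2$ and $\dim(V)$ is either finite or countably infinite. If $\mathcal F$ is simultaneously orthogonalizable, then the family $\{T_i\}_{i\in I}$ of (i) is simultaneously diagonalizable. Conversely, when $\{T_i\}_{i\in I}$ is simultaneously diagonalizable, consider the root space decomposition $V=\bigoplus_\alpha V_\alpha$, where $\alpha$ ranges over the roots of $\{T_i\}_{i\in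 I}$. If for each $\alpha$ the subspace $V_\alpha^{\circ}=\{x\in V_\alpha\colon\langle x,x\rangle_0=0\}$ is such that $V_\alpha^\circ$ is not $\perp$-closed or $V_\alpha/V_\alpha^\circ$ is infinite-dimensional, then $\mathcal F$ is simultaneously orthogonalizable.
   Context: An inner product on a $\mathbb{K}$-vector space $V$ is a symmetric bilinear form $\langle\cdot,\cdot\rangle\colon V\times V\to\mathbb{K}$; its radical is $\mathrm{rad}(\langle\cdot,\cdot\rangle)=\{x\in V\colon\langle x,V\rangle=0\}$, and it is nondegenerate if its radical is $0$. For a subspace $U$, $U^\perp=\{x\in V\colon\langle x,U\rangle=0\}$, and $v^\perp:=(\mathbb{K}v)^\perp$. $U$ is $\perp$-closed if $U^{\perp\perp}=U$ (here $\perp$ is relative to $\langle\cdot,\cdot\rangle_0$). If $\langle\cdot,\cdot\rangle$ is nondegenerate, the $\langle\cdot,\cdot\rangle$-topology of $V$ is the topology in which a basis of neighborhoods of $x\in V$ is given by the sets $x+\bigcap_{k=1}^n v_k^\perp$ with $v_1,\dots,v_n\in V$ a finite collection. $\mathbb{K}$ carries the discrete topology. A map $B\colon X\times X\to Y$ ($X,Y$ topological spaces) is partially continuous if $B(x,\_)$ and $B(\_,x)$ are continuous maps $X\to Y$ for every $x\in X$. A family of inner products on $V$ is nondegenerate if it contains an element $\langle\cdot,\cdot\rangle_0$ with zero radical such that every element of the family is partially continuous relative to the $\langle\cdot,\cdot\rangle_0$-topology of $V$. A family $\{\langle\cdot,\cdot\rangle_i\}$ is simultaneously orthogonalizable if there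 is a basis $\{v_j\}$ of $V$ with $\langle v_j,v_k\rangle_i=0$ for all $i$ and all $j\neq k$. A family $\mathcal T\subset\mathrm{End}(V)$ is simultaneously diagonalizable if there is a basis $B$ of $V$ with $T(v)\in\mathbb{K}v$ for all $v\in B$, $T\in\mathcal T$. A root of $\mathcal T\subset \mathrm{End}(V)$ is a map $\alpha\colon\mathcal T\to\mathbb{K}$ for which there is a nonzero $v\in V$ with $T(v)=\alpha(T)v$ for all $T\in\mathcal T$; its root space is $V_\alpha=\{w\in V\colon T(w)=\alpha(T)w\ \forall T\in\mathcal T\}$. *)

theory Defs
  imports "HOL-Analysis.Abstract_Topology" "HOL-Library.FuncSet" "HOL-Library.Countable_Set"
begin

text \<open>
  The vector space \<open>V\<close> over \<open>\<K>\<close> is the whole type \<open>'v\<close> with scalar multiplication \<open>smul\<close>, subject to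
  \<^locale>\<open>vector_space\<close>.
\<close>

definition is_basis ::
  "('k::field \<Rightarrow> 'v::ab_group_add \<Rightarrow> 'v) \<Rightarrow> 'v set \<Rightarrow> bool" where
  "is_basis smul B \<longleftrightarrow> \<not> module.dependent smul B \<and> module.span smul B = UNIV"

definition countable_dimension ::
  "('k::field \<Rightarrow> 'v::ab_group_add \<Rightarrow> 'v) \<Rightarrow> bool" where
  "countable_dimension smul \<longleftrightarrow> (\<exists>B. is_basis smul B \<and> countable B)"

definition inner_product ::
  "('k::field \<Rightarrow> 'v::ab_group_add \<Rightarrow> 'v) \<Rightarrow> ('v \<Rightarrow> 'v \<Rightarrow> 'k) \<Rightarrow> bool" where
  "inner_product smul ip \<longleftrightarrow>
     (\<forall>x. Vector_Spaces.linear smul (*) (\<lambda>y. ip x y)) \<and>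
     (\<forall>y. Vector_Spaces.linear smul (*) (\<lambda>x. ip x y)) \<and>
     (\<forall>x y. ip x y = ip y x)"

definition radical :: "('v \<Rightarrow> 'v \<Rightarrow> 'k::zero) \<Rightarrow> 'v set" where
  "radical ip = {x. \<forall>y. ip x y = 0}"

definition perp :: "('v \<Rightarrow> 'v \<Rightarrow> 'k::zero) \<Rightarrow> 'v set \<Rightarrow> 'v set" where
  "perp ip U = {x. \<forall>u\<in>U. ip x u = 0}"

definition perp_closed :: "('v \<Rightarrow> 'v \<Rightarrow> 'k::zero) \<Rightarrow> 'v set \<Rightarrow> bool" where
  "perp_closed ip U \<longleftrightarrow> perp ip (perp ip U) = U"

text \<open>
  The set \<open>x + \<Inter>\<^sub>v v\<^sup>\<bottom>\<close>, \<open>v\<close> ranging over \<open>S\<close>; for \<open>S = {}\<close> it is the whole space, which is also \<open>x + 0\<^sup>\<bottom>\<close>.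
\<close>

definition basic_nhd ::
  "('k::field \<Rightarrow> 'v::ab_group_add \<Rightarrow> 'v) \<Rightarrow> ('v \<Rightarrow> 'v \<Rightarrow> 'k) \<Rightarrow> 'v \<Rightarrow> 'v set \<Rightarrow> 'v set" where
  "basic_nhd smul ip x S = (\<lambda>w. x + w) ` (\<Inter>v\<in>S. perp ip (module.span smul {v}))"

definition ip_topology ::
  "('k::field \<Rightarrow> 'v::ab_group_add \<Rightarrow> 'v) \<Rightarrow> ('v \<Rightarrow> 'v \<Rightarrow> 'k) \<Rightarrow> 'v topology" where
  "ip_topology smul ip =
     topology (\<lambda>U. \<forall>x\<in>U. \<exists>S. finite S \<and> basic_nhd smul ip x S \<subseteq> U)"

lemma openin_ip_topology:
  "openin (ip_topology smul ip) U \<longleftrightarrow> (\<forall>x\<in>U. \<exists>S. finite S \<and> basic_nhd smul ip x S \<subseteq> U)"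
proof -
  have anti: "basic_nhd smul ip x (S \<union> T) \<subseteq> basic_nhd smul ip x S \<inter> basic_nhd smul ip x T"
    for x S T
    by (auto simp: basic_nhd_def)
  have "istopology (\<lambda>U. \<forall>x\<in>U. \<exists>S. finite S \<and> basic_nhd smul ip x S \<subseteq> U)"
    unfolding istopology_def
  proof (intro conjI allI impI ballI)
    fix U W x
    assume U: "\<forall>x\<in>U. \<exists>S. finite S \<and> basic_nhd smul ip x S \<subseteq> U"
      and W: "\<forall>x\<in>W. \<exists>S. finite S \<and> basic_nhd smul ip x S \<subseteq> W" and x: "x \<in> U \<inter> W"
    obtain S T where "finite S" "basic_nhd smul ip x S \<subseteq> U"
      "finite T" "basic_nhd smul ip x T \<subseteq> W"
      using U W x by blast
    then show "\<exists>S. finite S \<and> basic_nhd smul ip x S \<subseteq> U \<inter> W"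
      using anti[of x S T] by (intro exI[of _ "S \<union> T"]) auto
  next
    fix \<U> x
    assume "\<forall>U\<in>\<U>. \<forall>x\<in>U. \<exists>S. finite S \<and> basic_nhd smul ip x S \<subseteq> U" "x \<in> \<Union>\<U>"
    then show "\<exists>S. finite S \<and> basic_nhd smul ip x S \<subseteq> \<Union>\<U>"
      by (meson Union_iff Union_upper order_trans)
  qed
  then show ?thesis
    by (simp add: ip_topology_def topology_inverse')
qed

lemma topspace_ip_topology [simp]: "topspace (ip_topology smul ip) = UNIV"
proof -
  have "openin (ip_topology smul ip) UNIV"
    unfolding openin_ip_topology by auto
  then show ?thesis
    using openin_subset by blast
qed

definition partially_continuous ::
  "'a topology \<Rightarrow> 'b topology \<Rightarrow> ('a \<Rightarrow> 'a \<Rightarrow> 'b) \<Rightarrow> bool" where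
  "partially_continuous X Y b \<longleftrightarrow>
     (\<forall>x\<in>topspace X. continuous_map X Y (\<lambda>y. b x y) \<and> continuous_map X Y (\<lambda>y. b y x))"

text \<open>A nondegenerate family \<open>\<F>\<close>, with its distinguished element \<open>ip0\<close> made explicit.\<close>

definition nondegenerate_family_at ::
  "('k::field \<Rightarrow> 'v::ab_group_add \<Rightarrow> 'v) \<Rightarrow> ('v \<Rightarrow> 'v \<Rightarrow> 'k) \<Rightarrow> ('v \<Rightarrow> 'v \<Rightarrow> 'k) set \<Rightarrow> bool" where
  "nondegenerate_family_at smul ip0 \<F> \<longleftrightarrow>
     (\<forall>ip\<in>\<F>. inner_product smul ip) \<and>
     ip0 \<in> \<F> \<and> radical ip0 = {0} \<and>
     (\<forall>ip\<in>\<F>. partially_continuous (ip_topology smul ip0) (discrete_topology UNIV) ip)"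

definition orthogonal_set :: "('v \<Rightarrow> 'v \<Rightarrow> 'k::zero) \<Rightarrow> 'v set \<Rightarrow> bool" where
  "orthogonal_set ip B \<longleftrightarrow> (\<forall>v\<in>B. \<forall>w\<in>B. v \<noteq> w \<longrightarrow> ip v w = 0)"

definition simultaneously_orthogonalizable ::
  "('k::field \<Rightarrow> 'v::ab_group_add \<Rightarrow> 'v) \<Rightarrow> ('v \<Rightarrow> 'v \<Rightarrow> 'k) set \<Rightarrow> bool" where
  "simultaneously_orthogonalizable smul \<F> \<longleftrightarrow>
     (\<exists>B. is_basis smul B \<and> (\<forall>ip\<in>\<F>. orthogonal_set ip B))"

definition diagonal_on ::
  "('k::field \<Rightarrow> 'v::ab_group_add \<Rightarrow> 'v) \<Rightarrow> 'v set \<Rightarrow> ('v \<Rightarrow> 'v) \<Rightarrow> bool" where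
  "diagonal_on smul B T \<longleftrightarrow> (\<forall>v\<in>B. T v \<in> module.span smul {v})"

definition simultaneously_diagonalizable ::
  "('k::field \<Rightarrow> 'v::ab_group_add \<Rightarrow> 'v) \<Rightarrow> ('v \<Rightarrow> 'v) set \<Rightarrow> bool" where
  "simultaneously_diagonalizable smul \<T> \<longleftrightarrow>
     (\<exists>B. is_basis smul B \<and> (\<forall>T\<in>\<T>. diagonal_on smul B T))"

definition self_adjoint :: "('v \<Rightarrow> 'v \<Rightarrow> 'k) \<Rightarrow> ('v \<Rightarrow> 'v) \<Rightarrow> bool" where
  "self_adjoint ip T \<longleftrightarrow> (\<forall>x y. ip (T x) y = ip x (T y))"

text \<open>
  A root is a map on \<open>\<T>\<close> only; \<^const>\<open>extensional\<close> makes roots agreeing on \<open>\<T>\<close> equal, so that no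
  root space is counted twice in the direct sum.
\<close>

definition roots ::
  "('k::field \<Rightarrow> 'v::ab_group_add \<Rightarrow> 'v) \<Rightarrow> ('v \<Rightarrow> 'v) set \<Rightarrow> (('v \<Rightarrow> 'v) \<Rightarrow> 'k) set" where
  "roots smul \<T> = {\<alpha> \<in> extensional \<T>. \<exists>v. v \<noteq> 0 \<and> (\<forall>T\<in>\<T>. T v = smul (\<alpha> T) v)}"

definition root_space ::
  "('k::field \<Rightarrow> 'v::ab_group_add \<Rightarrow> 'v) \<Rightarrow> ('v \<Rightarrow> 'v) set \<Rightarrow> (('v \<Rightarrow> 'v) \<Rightarrow> 'k) \<Rightarrow> 'v set" where
  "root_space smul \<T> \<alpha> = {w. \<forall>T\<in>\<T>. T w = smul (\<alpha> T) w}"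

definition internal_direct_sum ::
  "('k::field \<Rightarrow> 'v::ab_group_add \<Rightarrow> 'v) \<Rightarrow> 'a set \<Rightarrow> ('a \<Rightarrow> 'v set) \<Rightarrow> bool" where
  "internal_direct_sum smul A W \<longleftrightarrow>
     (\<forall>\<alpha>\<in>A. module.subspace smul (W \<alpha>)) \<and>
     (\<forall>x. \<exists>!f. (\<forall>\<alpha>\<in>A. f \<alpha> \<in> W \<alpha>) \<and> (\<forall>\<alpha>. \<alpha> \<notin> A \<longrightarrow> f \<alpha> = 0) \<and>
               finite {\<alpha>. f \<alpha> \<noteq> 0} \<and> x = (\<Sum>\<alpha> | f \<alpha> \<noteq> 0. f \<alpha>))"

definition isotropic_part :: "('v \<Rightarrow> 'v \<Rightarrow> 'k::zero) \<Rightarrow> 'v set \<Rightarrow> 'v set" where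
  "isotropic_part ip U = {x \<in> U. ip x x = 0}"

definition quotient_space :: "'v::ab_group_add set \<Rightarrow> 'v set \<Rightarrow> 'v set set" where
  "quotient_space U W = (\<lambda>x. (\<lambda>w. x + w) ` W) ` U"

text \<open>
  \<open>U/W\<close> is finite-dimensional iff it is spanned by the classes of finitely many elements of \<open>U\<close>. A linear
  combination of the classes of elements of \<open>S\<close> is the class of the same linear combination of
  those elements, so that these classes span the image of the span of \<open>S\<close>.
\<close>

definition quotient_finite_dimensional ::
  "('k::field \<Rightarrow> 'v::ab_group_add \<Rightarrow> 'v) \<Rightarrow> 'v set \<Rightarrow> 'v set \<Rightarrow> bool" where
  "quotient_finite_dimensional smul U W \<longleftrightarrow>
     (\<exists>S. finite S \<and> S \<subseteq> U \<and> quotient_space U W = quotient_space (module.span smul S) W)"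

end

theory Submission
  imports Defs
begin

text \<open>
  Write \<open>\<langle>x,y\<rangle>\<close> for the distinguished form. A basic neighborhood of \<open>0\<close> is a finite intersection of
  kernels \<open>v\<^sup>\<bottom>\<close>, and a functional vanishing on such an intersection is a linear combination of the
  functionals \<open>\<langle>v,_\<rangle>\<close> (\<open>functional_represented\<close>). So partial continuity says exactly that
  \<open>\<langle>x,_\<rangle>\<^sub>i\<close> has the form \<open>\<langle>T\<^sub>i x,_\<rangle>\<close>; nondegeneracy makes \<open>T\<^sub>i\<close> linear, and symmetry of
  \<open>\<langle>_,_\<rangle>\<^sub>i\<close> makes it self-adjoint. The vectors of an orthogonal basis are not isotropic, so the
  inner products with them detect the coefficients of \<open>T\<^sub>i v\<close>; therefore such a basis is orthogonal for
  \<open>\<langle>_,_\<rangle>\<^sub>i\<close> if and only if it consists of eigenvectors of \<open>T\<^sub>i\<close> (\<open>orthogonal_iff_diagonal\<close>).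

  Suppose now that the \<open>T\<^sub>i\<close> are simultaneously diagonalizable. Distinct root spaces are orthogonal
  because the operators are self-adjoint. Since the root spaces span a space with a nondegenerate form,
  their sum is direct, each of them is nondegenerate and \<open>\<bottom>\<close>-closed, and it remains to find an
  orthogonal basis in each root space \<open>E\<close> separately (\<open>orthogonal_eigenbasis\<close>). A countable spanning
  set of \<open>E\<close> is processed by the Gram--Schmidt procedure. It can get stuck only at an isotropic vector
  \<open>x\<close> in the complement \<open>G\<close> of the finite set \<open>F\<close> found so far, and it continues if some
  non-isotropic \<open>y \<in> G\<close> is not orthogonal to \<open>x\<close> (\<open>gram_schmidt_step\<close>). If the characteristic
  is not \<open>2\<close>, such a \<open>y\<close> exists by polarization. In characteristic \<open>2\<close> it exists unless \<open>G\<close> is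
  alternating, and then the isotropic part of \<open>E\<close> contains \<open>G\<close>, so that it is \<open>\<bottom>\<close>-closed and of finite
  codimension (\<open>alternating_complement_char_2\<close>), which the hypothesis of the theorem excludes.
\<close>

section \<open>Symmetric bilinear forms and orthogonal frames\<close>

locale symmetric_form = vector_space smul
  for smul :: "'k::field \<Rightarrow> 'v::ab_group_add \<Rightarrow> 'v" (infixr "*s" 75) +
  fixes form :: "'v \<Rightarrow> 'v \<Rightarrow> 'k"
  assumes inner: "inner_product smul form"
begin

lemma form_sym: "form x y = form y x"
  using inner unfolding inner_product_def by blast

lemma linear_form: "Vector_Spaces.linear smul (*) (form x)"
  using inner unfolding inner_product_def by blast

lemma form_add_right: "form x (y + z) = form x y + form x z"
  using linear_form[of x] by (simp add: Vector_Spaces.linear_iff)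

lemma form_scale_right: "form x (c *s y) = c * form x y"
  using linear_form[of x] by (simp add: Vector_Spaces.linear_iff)

lemma form_add_left: "form (y + z) x = form y x + form z x"
  by (metis form_add_right form_sym)

lemma form_scale_left: "form (c *s y) x = c * form y x"
  by (metis form_scale_right form_sym)

lemma form_zero_right [simp]: "form x 0 = 0"
  using form_scale_right[of x 0 0] by simp

lemma form_zero_left [simp]: "form 0 x = 0"
  using form_sym[of 0 x] by simp

lemma form_minus_right: "form x (- y) = - form x y"
  using form_add_right[of x y "- y"] by (simp add: eq_neg_iff_add_eq_0 add.commute)

lemma form_diff_right: "form x (y - z) = form x y - form x z"
  using form_add_right[of x y "- z"] by (simp add: form_minus_right)

lemma form_diff_left: "form (y - z) x = form y x - form z x"
  using form_diff_right[of x y z] by (simp add: form_sym)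

lemma form_sum_left: "form (sum f A) y = (\<Sum>a\<in>A. form (f a) y)"
  by (induction A rule: infinite_finite_induct) (simp_all add: form_add_left)

lemmas form_bilinear = form_add_left form_add_right form_diff_left form_diff_right
  form_scale_left form_scale_right

lemma form_zero_on_span:
  assumes "\<forall>f\<in>F. form x f = 0" "w \<in> span F"
  shows "form x w = 0"
  using assms(2)
  by (induction rule: span_induct_alt) (simp_all add: assms(1) form_bilinear)

definition orthogonal_frame :: "'v set \<Rightarrow> bool" where
  "orthogonal_frame F \<longleftrightarrow> orthogonal_set form F \<and> (\<forall>v\<in>F. form v v \<noteq> 0)"

lemma orthogonal_frame_insert:
  assumes "orthogonal_frame F" "form y y \<noteq> 0" "\<forall>f\<in>F. form y f = 0"
  shows "orthogonal_frame (insert y F)"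
proof -
  have "\<forall>f\<in>F. form f y = 0"
    using assms(3) form_sym by metis
  then show ?thesis
    using assms unfolding orthogonal_frame_def orthogonal_set_def by auto
qed

lemma independent_orthogonal_frame:
  assumes "orthogonal_frame F"
  shows "independent F"
proof
  assume "dependent F"
  then obtain v where v: "v \<in> F" "v \<in> span (F - {v})"
    unfolding dependent_def by blast
  have "form v v = 0"
    using assms v by (intro form_zero_on_span[of "F - {v}"])
      (auto simp: orthogonal_frame_def orthogonal_set_def)
  then show False
    using assms v(1) unfolding orthogonal_frame_def by blast
qed

text \<open>
  On a finite frame a vector with prescribed inner products is written down directly. Prescribing
  \<open>form x\<close> gives the orthogonal projection of \<open>x\<close>; prescribing an arbitrary functional gives its
  representing vector.
\<close>

lemma frame_prescribed_products:
  assumes "finite F" "orthogonal_frame F"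
  obtains p where "p \<in> span F" "\<forall>f\<in>F. form p f = c f"
proof
  define p where "p = (\<Sum>f\<in>F. (c f / form f f) *s f)"
  show "p \<in> span F"
    unfolding p_def by (intro span_sum span_scale span_base)
  show "\<forall>f\<in>F. form p f = c f"
  proof
    fix g assume g: "g \<in> F"
    have "form p g = (\<Sum>f\<in>F. if f = g then c g else 0)"
      unfolding p_def form_sum_left
      using assms(2) g by (intro sum.cong refl)
        (auto simp: form_scale_left orthogonal_frame_def orthogonal_set_def)
    then show "form p g = c g"
      using assms(1) g by simp
  qed
qed

lemma frame_projection:
  assumes "finite F" "orthogonal_frame F"
  obtains p where "p \<in> span F" "\<forall>f\<in>F. form (x - p) f = 0"
  using frame_prescribed_products[OF assms, of "form x"]
  by (metis cancel_comm_monoid_add_class.diff_cancel form_diff_left)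

definition nondegenerate_on :: "'v set \<Rightarrow> bool" where
  "nondegenerate_on E \<longleftrightarrow> (\<forall>x\<in>E. (\<forall>y\<in>E. form x y = 0) \<longrightarrow> x = 0)"

lemma nondegenerate_on_frame_complement:
  assumes "nondegenerate_on E" "subspace E" "finite F" "F \<subseteq> E" "orthogonal_frame F"
    and "x \<in> E" "x \<noteq> 0" "\<forall>f\<in>F. form x f = 0"
  obtains y where "y \<in> E" "\<forall>f\<in>F. form y f = 0" "form x y \<noteq> 0"
proof -
  obtain w where w: "w \<in> E" "form x w \<noteq> 0"
    using assms(1,6,7) unfolding nondegenerate_on_def by blast
  obtain p where p: "p \<in> span F" "\<forall>f\<in>F. form (w - p) f = 0"
    using frame_projection[OF assms(3,5)] by blast
  have "p \<in> E"
    using p(1) span_minimal[OF assms(4,2)] by blast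
  moreover have "form x p = 0"
    by (rule form_zero_on_span[OF assms(8) p(1)])
  ultimately show thesis
    using that[of "w - p"] w p(2) assms(2) by (simp add: subspace_diff form_diff_right)
qed


section \<open>Orthogonal bases of spaces of countable dimension\<close>

text \<open>
  If the part \<open>x\<close> of the new vector that is orthogonal to \<open>F\<close> is isotropic,
  it cannot be added by itself. With a partner \<open>y\<close> as in the hypothesis, the plane spanned by \<open>x\<close>
  and \<open>y\<close> still has an orthogonal frame: \<open>y\<close> and \<open>x' = x - (\<langle>x,y\<rangle>/\<langle>y,y\<rangle>) y\<close>, where
  \<open>\<langle>x',x'\<rangle> = - \<langle>x,y\<rangle>\<^sup>2/\<langle>y,y\<rangle>\<close> does not vanish.
\<close>

lemma gram_schmidt_step:
  assumes E: "subspace E" and F: "finite F" "F \<subseteq> E" "orthogonal_frame F" and v: "v \<in> E"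
    and partner: "\<And>x. x \<in> E \<Longrightarrow> x \<noteq> 0 \<Longrightarrow> form x x = 0 \<Longrightarrow> \<forall>f\<in>F. form x f = 0 \<Longrightarrow>
      \<exists>y\<in>E. (\<forall>f\<in>F. form y f = 0) \<and> form x y \<noteq> 0 \<and> form y y \<noteq> 0"
  shows "\<exists>F'. F \<subseteq> F' \<and> finite F' \<and> F' \<subseteq> E \<and> orthogonal_frame F' \<and> v \<in> span F'"
proof -
  obtain p where p: "p \<in> span F" "\<forall>f\<in>F. form (v - p) f = 0"
    using frame_projection[OF F(1,3)] by blast
  define x where "x = v - p"
  have xF: "\<forall>f\<in>F. form x f = 0" and v_eq: "v = x + p"
    using p(2) by (simp_all add: x_def)
  have xE: "x \<in> E"
    using p(1) span_minimal[OF F(2) E] v E by (auto simp: x_def intro: subspace_diff)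
  have v_span: "v \<in> span F'" if "F \<subseteq> F'" "x \<in> span F'" for F'
    using that p(1) span_mono[of F F'] unfolding v_eq by (auto intro: span_add)
  consider "x = 0" | "form x x \<noteq> 0" | "x \<noteq> 0" "form x x = 0" by blast
  then show ?thesis
  proof cases
    case 1
    then show ?thesis using F v_span[of F] by (auto simp: span_zero)
  next
    case 2
    then show ?thesis
      using F xE xF v_span[of "insert x F"] orthogonal_frame_insert[OF F(3)]
      by (intro exI[of _ "insert x F"]) (auto simp: span_base)
  next
    case 3
    then obtain y where y: "y \<in> E" "\<forall>f\<in>F. form y f = 0" "form x y \<noteq> 0" "form y y \<noteq> 0"
      using partner xE xF by blast
    define c where "c = form x y / form y y"
    define x' where "x' = x - c *s y"
    have x'y: "form x' y = 0"
      using y(4) by (simp add: x'_def c_def form_bilinear)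
    have "form x' x' = form x' x - c * form x' y"
      by (subst (2) x'_def) (simp add: form_diff_right form_scale_right)
    also have "\<dots> = - c * form x y"
      using 3(2) x'y by (simp add: x'_def form_bilinear form_sym[of y x])
    finally have x'x': "form x' x' \<noteq> 0"
      using y(3,4) by (simp add: c_def)
    have x'F: "\<forall>f\<in>F. form x' f = 0"
      using xF y(2) by (simp add: x'_def form_bilinear)
    have x'E: "x' \<in> E"
      using xE y(1) E by (simp add: x'_def subspace_diff subspace_scale)
    have "orthogonal_frame (insert x' (insert y F))"
      using F(3) y x'x' x'F x'y by (intro orthogonal_frame_insert) auto
    moreover have "x \<in> span (insert x' (insert y F))"
    proof -
      have "x = x' + c *s y" by (simp add: x'_def)
      then show ?thesis by (metis insertCI span_add span_base span_scale)
    qed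
    ultimately show ?thesis
      using F y(1) x'E v_span[of "insert x' (insert y F)"]
      by (intro exI[of _ "insert x' (insert y F)"]) auto
  qed
qed

lemma gram_schmidt_countable:
  assumes E: "subspace E" and C: "countable C" "C \<subseteq> E" "E \<subseteq> span C"
    and partner: "\<And>F x. finite F \<Longrightarrow> F \<subseteq> E \<Longrightarrow> orthogonal_frame F \<Longrightarrow>
      x \<in> E \<Longrightarrow> x \<noteq> 0 \<Longrightarrow> form x x = 0 \<Longrightarrow> \<forall>f\<in>F. form x f = 0 \<Longrightarrow>
      \<exists>y\<in>E. (\<forall>f\<in>F. form y f = 0) \<and> form x y \<noteq> 0 \<and> form y y \<noteq> 0"
  shows "\<exists>B. B \<subseteq> E \<and> orthogonal_frame B \<and> E \<subseteq> span B"
proof -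
  \<comment> \<open>Adding \<open>0\<close> makes the set nonempty, so that it can be enumerated by \<open>\<nat>\<close>.\<close>
  define c where "c = from_nat_into (insert 0 C)"
  have c: "c n \<in> E" for n
    using from_nat_into[of "insert 0 C" n] C(2) subspace_0[OF E] by (auto simp: c_def)
  define P where "P F \<longleftrightarrow> finite F \<and> F \<subseteq> E \<and> orthogonal_frame F" for F
  have "\<exists>F. \<forall>n. P (F n) \<and> (F n \<subseteq> F (Suc n) \<and> c n \<in> span (F (Suc n)))"
  proof (rule dependent_nat_choice)
    show "\<exists>F. P F"
      by (rule exI[of _ "{}"]) (auto simp: P_def orthogonal_frame_def orthogonal_set_def)
  next
    fix F n assume "P F"
    then show "\<exists>F'. P F' \<and> (F \<subseteq> F' \<and> c n \<in> span F')"
      using gram_schmidt_step[OF E _ _ _ c[of n], of F] partner[of F] unfolding P_def by blast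
  qed
  then obtain F where F: "\<And>n. P (F n)" "\<And>n. F n \<subseteq> F (Suc n)" "\<And>n. c n \<in> span (F (Suc n))"
    by blast
  have mono: "F m \<subseteq> F n" if "m \<le> n" for m n
    using lift_Suc_mono_le[of F, OF F(2) that] .
  define B where "B = (\<Union>n. F n)"
  have "B \<subseteq> E" using F(1) unfolding B_def P_def by blast
  moreover have "orthogonal_frame B"
    unfolding orthogonal_frame_def orthogonal_set_def
  proof (intro conjI ballI impI)
    fix v w assume "v \<in> B" "w \<in> B" and ne: "v \<noteq> w"
    then obtain m n where "v \<in> F m" "w \<in> F n" unfolding B_def by blast
    then have "v \<in> F (max m n)" "w \<in> F (max m n)"
      using mono[of m "max m n"] mono[of n "max m n"] by auto
    then show "form v w = 0"
      using F(1)[of "max m n"] ne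
      unfolding P_def orthogonal_frame_def orthogonal_set_def by blast
  next
    fix v assume "v \<in> B"
    then show "form v v \<noteq> 0"
      using F(1) unfolding B_def P_def orthogonal_frame_def by blast
  qed
  moreover have "C \<subseteq> span B"
  proof
    fix x assume "x \<in> C"
    then obtain n where "c n = x"
      unfolding c_def using from_nat_into_surj[of "insert 0 C" x] C(1) by auto
    then show "x \<in> span B"
      using F(3)[of n] span_mono[of "F (Suc n)" B] unfolding B_def by blast
  qed
  then have "E \<subseteq> span B"
    using C(3) span_minimal[of C "span B"] by auto
  ultimately show ?thesis by blast
qed

text \<open>
  Where \<open>2\<close> is invertible the isotropic vector \<open>x\<close> serves to correct a partner that is isotropic as
  well, because then \<open>\<langle>x + y, x + y\<rangle> = 2 \<langle>x,y\<rangle>\<close>.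
\<close>

lemma orthogonal_basis_char_not_2:
  assumes "(2::'k) \<noteq> 0" "nondegenerate_on E" "subspace E" "countable C" "C \<subseteq> E" "E \<subseteq> span C"
  shows "\<exists>B. B \<subseteq> E \<and> orthogonal_frame B \<and> E \<subseteq> span B"
proof (rule gram_schmidt_countable[OF assms(3-6)])
  fix F x
  assume F: "finite F" "F \<subseteq> E" "orthogonal_frame F"
    and x: "x \<in> E" "x \<noteq> 0" "form x x = 0" "\<forall>f\<in>F. form x f = 0"
  obtain y where y: "y \<in> E" "\<forall>f\<in>F. form y f = 0" "form x y \<noteq> 0"
    using nondegenerate_on_frame_complement[OF assms(2,3) F x(1,2,4)] by blast
  show "\<exists>y\<in>E. (\<forall>f\<in>F. form y f = 0) \<and> form x y \<noteq> 0 \<and> form y y \<noteq> 0"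
  proof (cases "form y y = 0")
    case True
    have "form (x + y) (x + y) = 2 * form x y"
      using True x(3) by (simp add: form_bilinear form_sym[of y x])
    then have "form (x + y) (x + y) \<noteq> 0"
      using assms(1) y(3) by simp
    moreover have "form x (x + y) \<noteq> 0" "\<forall>f\<in>F. form (x + y) f = 0"
      using x(3,4) y(2,3) by (simp_all add: form_add_left form_add_right)
    moreover have "x + y \<in> E"
      using assms(3) x(1) y(1) by (rule subspace_add)
    ultimately show ?thesis by blast
  next
    case False
    then show ?thesis using y by blast
  qed
qed

lemma separating_functional:
  assumes "subspace U" "p \<notin> U"
  obtains \<phi> where "Vector_Spaces.linear smul (*) \<phi>" "\<phi> p = 1" "\<forall>u\<in>U. \<phi> u = 0"
proof -
  have "vector_space ((*) :: 'k \<Rightarrow> 'k \<Rightarrow> 'k)"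
    by unfold_locales (simp_all add: distrib_left distrib_right)
  then have vp: "vector_space_pair smul ((*) :: 'k \<Rightarrow> 'k \<Rightarrow> 'k)"
    using vector_space_axioms by (simp add: vector_space_pair_def)
  obtain D where D: "D \<subseteq> U" "independent D" "U \<subseteq> span D"
    using maximal_independent_subset[of U] by blast
  have "p \<notin> span D"
    using span_minimal[OF D(1) assms(1)] assms(2) by blast
  then have "independent (insert p D)"
    using D(2) by (simp add: independent_insertI)
  then obtain \<phi> where \<phi>: "Vector_Spaces.linear smul (*) \<phi>"
    "\<forall>x\<in>insert p D. \<phi> x = (if x = p then 1 else 0)"
    using vector_space_pair.linear_independent_extend[OF vp, of "insert p D" "\<lambda>x. if x = p then 1 else 0"]
    by blast
  have "\<forall>d\<in>D. \<phi> d = 0"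
    using \<phi>(2) D(1) assms(2) by auto
  then have "\<forall>u\<in>U. \<phi> u = 0"
    using vector_space_pair.linear_eq_0_on_span[OF vp \<phi>(1), of D] D(3) by blast
  then show thesis using that \<phi> by auto
qed

text \<open>
  In characteristic \<open>2\<close> the cross terms of \<open>\<langle>x + y, x + y\<rangle>\<close> cancel, so isotropy is preserved by
  addition.
\<close>

lemma form_add_self_char_2:
  assumes "(2::'k) = 0"
  shows "form (x + y) (x + y) = form x x + form y y"
proof -
  have "form (x + y) (x + y) = form x x + form y y + 2 * form x y"
    by (simp add: form_bilinear form_sym[of y x])
  then show ?thesis using assms by simp
qed

lemma subspace_isotropic_part_char_2:
  assumes "(2::'k) = 0" "subspace E"
  shows "subspace (isotropic_part form E)"
  by (rule subspaceI)
    (use assms in \<open>simp_all add: isotropic_part_def form_add_self_char_2 form_scale_left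
      form_scale_right subspace_0 subspace_add subspace_scale\<close>)

text \<open>
  The only obstruction to Gram--Schmidt in characteristic \<open>2\<close> is a finite frame \<open>F\<close> whose complement
  in \<open>E\<close> is alternating. Then \<open>E\<close> is the span of \<open>F\<close> plus isotropic vectors. Thus \<open>F\<close> spans
  the quotient by the isotropic part, and within the closed space \<open>E\<close> the isotropic part is the
  annihilator of a subspace of the finite-dimensional nondegenerate space \<open>span F\<close>, hence closed.
\<close>

lemma alternating_complement_char_2:
  assumes two: "(2::'k) = 0" and E: "subspace E" "perp form (perp form E) \<subseteq> E"
    and F: "finite F" "F \<subseteq> E" "orthogonal_frame F"
    and alt: "\<And>z. z \<in> E \<Longrightarrow> \<forall>f\<in>F. form z f = 0 \<Longrightarrow> form z z = 0"
  shows "perp_closed form (isotropic_part form E)"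
    and "quotient_finite_dimensional smul E (isotropic_part form E)"
proof -
  let ?E0 = "isotropic_part form E"
  have E0: "subspace ?E0" by (rule subspace_isotropic_part_char_2[OF two E(1)])
  have FE: "span F \<subseteq> E" by (rule span_minimal[OF F(2) E(1)])
  have split: "\<exists>p\<in>span F. x - p \<in> ?E0 \<and> (\<forall>w\<in>span F. form w (x - p) = 0)" if "x \<in> E" for x
  proof -
    obtain p where p: "p \<in> span F" "\<forall>f\<in>F. form (x - p) f = 0"
      using frame_projection[OF F(1,3)] by blast
    have "x - p \<in> E" using that p(1) FE E(1) by (auto intro: subspace_diff)
    then have "x - p \<in> ?E0"
      using alt p(2) by (simp add: isotropic_part_def)
    moreover have "\<forall>w\<in>span F. form w (x - p) = 0"
      using form_zero_on_span[OF p(2)] form_sym by metis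
    ultimately show ?thesis using p(1) by blast
  qed
  show "quotient_finite_dimensional smul E ?E0"
    unfolding quotient_finite_dimensional_def
  proof (intro exI[of _ F] conjI F(1,2))
    show "quotient_space E ?E0 = quotient_space (span F) ?E0"
    proof
      show "quotient_space (span F) ?E0 \<subseteq> quotient_space E ?E0"
        using FE unfolding quotient_space_def by blast
      show "quotient_space E ?E0 \<subseteq> quotient_space (span F) ?E0"
      proof
        fix Q assume "Q \<in> quotient_space E ?E0"
        then obtain x where x: "x \<in> E" "Q = (\<lambda>w. x + w) ` ?E0"
          unfolding quotient_space_def by blast
        obtain p where p: "p \<in> span F" "x - p \<in> ?E0" using split x(1) by blast
        have "(\<lambda>w. x + w) ` ?E0 = (\<lambda>w. p + w) ` ?E0"
        proof (intro equalityI image_subsetI)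
          fix w assume "w \<in> ?E0"
          with E0 p(2) have "x - p + w \<in> ?E0" by (rule subspace_add)
          moreover have "x + w = p + (x - p + w)" by simp
          ultimately show "x + w \<in> (\<lambda>w. p + w) ` ?E0" by blast
        next
          fix w assume "w \<in> ?E0"
          from E0 this p(2) have "w - (x - p) \<in> ?E0" by (rule subspace_diff)
          moreover have "p + w = x + (w - (x - p))" by simp
          ultimately show "p + w \<in> (\<lambda>w. x + w) ` ?E0" by blast
        qed
        then show "Q \<in> quotient_space (span F) ?E0"
          using x(2) p(1) unfolding quotient_space_def by blast
      qed
    qed
  qed
  show "perp_closed form ?E0"
    unfolding perp_closed_def
  proof
    show "?E0 \<subseteq> perp form (perp form ?E0)"
      unfolding perp_def by (auto simp: form_sym)
    show "perp form (perp form ?E0) \<subseteq> ?E0"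
    proof
      fix x assume x: "x \<in> perp form (perp form ?E0)"
      have "perp form (perp form ?E0) \<subseteq> perp form (perp form E)"
        unfolding perp_def isotropic_part_def by blast
      then have xE: "x \<in> E" using x E(2) by blast
      obtain p where p: "p \<in> span F" "x - p \<in> ?E0" using split xE by blast
      have "p \<in> ?E0"
      proof (rule ccontr)
        assume "p \<notin> ?E0"
        then obtain \<phi> where \<phi>: "Vector_Spaces.linear smul (*) \<phi>" "\<phi> p = 1"
          "\<forall>u\<in>?E0. \<phi> u = 0"
          using separating_functional[OF E0] by blast
        obtain w where w: "w \<in> span F" "\<forall>f\<in>F. form w f = \<phi> f"
          using frame_prescribed_products[OF F(1,3)] by blast
        have w\<phi>: "form w u = \<phi> u" if "u \<in> span F" for u
        proof -
          have "\<phi> 0 = 0"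
            using \<phi>(3) subspace_0[OF E0] by blast
          with that show ?thesis
            using w(2) \<phi>(1)
            by (induction rule: span_induct_alt)
              (simp_all add: form_bilinear Vector_Spaces.linear_iff)
        qed
        \<comment> \<open>Both summands of \<open>e\<close> are harmless: the one in \<open>span F\<close> is again isotropic, so \<open>\<phi>\<close>
          kills it, and the other is orthogonal to \<open>span F\<close>.\<close>
        have "form w e = 0" if e: "e \<in> ?E0" for e
        proof -
          obtain p' where p': "p' \<in> span F" "e - p' \<in> ?E0" "form w (e - p') = 0"
            using split[of e] e w(1) unfolding isotropic_part_def by blast
          have "e - (e - p') \<in> ?E0"
            using E0 e p'(2) by (rule subspace_diff)
          then show ?thesis
            using p' w\<phi>[OF p'(1)] \<phi>(3) by (simp add: form_diff_right)
        qed
        then have wp: "w \<in> perp form ?E0" unfolding perp_def by blast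
        have "form x w = 0" using x wp unfolding perp_def by blast
        moreover have "form w (x - p) = 0" using wp p(2) unfolding perp_def by blast
        ultimately have "form w p = 0" by (simp add: form_diff_right form_sym[of x w])
        then show False using w\<phi>[OF p(1)] \<phi>(2) by simp
      qed
      then have "x - p + p \<in> ?E0" using p(2) E0 by (blast intro: subspace_add)
      then show "x \<in> ?E0" by simp
    qed
  qed
qed

text \<open>
  A partner \<open>y\<close> that is isotropic is corrected by a non-isotropic \<open>z\<close> orthogonal to the frame: either
  \<open>z\<close> itself or \<open>y + z\<close> will do.
\<close>

lemma orthogonal_basis_char_2:
  assumes two: "(2::'k) = 0" and nd: "nondegenerate_on E"
    and E: "subspace E" and C: "countable C" "C \<subseteq> E" "E \<subseteq> span C"
    and cl: "perp form (perp form E) \<subseteq> E"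
    and big: "\<not> perp_closed form (isotropic_part form E) \<or>
       \<not> quotient_finite_dimensional smul E (isotropic_part form E)"
  shows "\<exists>B. B \<subseteq> E \<and> orthogonal_frame B \<and> E \<subseteq> span B"
proof (rule gram_schmidt_countable[OF E C])
  fix F x
  assume F: "finite F" "F \<subseteq> E" "orthogonal_frame F"
    and x: "x \<in> E" "x \<noteq> 0" "form x x = 0" "\<forall>f\<in>F. form x f = 0"
  obtain y where y: "y \<in> E" "\<forall>f\<in>F. form y f = 0" "form x y \<noteq> 0"
    using nondegenerate_on_frame_complement[OF nd E F x(1,2,4)] by blast
  have "\<not> (\<forall>z\<in>E. (\<forall>f\<in>F. form z f = 0) \<longrightarrow> form z z = 0)"
  proof
    assume "\<forall>z\<in>E. (\<forall>f\<in>F. form z f = 0) \<longrightarrow> form z z = 0"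
    then have "z \<in> E \<Longrightarrow> \<forall>f\<in>F. form z f = 0 \<Longrightarrow> form z z = 0" for z by blast
    from alternating_complement_char_2[OF two E cl F this] big show False by blast
  qed
  then obtain z where z: "z \<in> E" "\<forall>f\<in>F. form z f = 0" "form z z \<noteq> 0"
    by blast
  consider "form y y \<noteq> 0" | "form x z \<noteq> 0" | "form y y = 0" "form x z = 0" by blast
  then show "\<exists>y\<in>E. (\<forall>f\<in>F. form y f = 0) \<and> form x y \<noteq> 0 \<and> form y y \<noteq> 0"
  proof cases
    case 1
    then show ?thesis using y by blast
  next
    case 2
    then show ?thesis using z by blast
  next
    case 3
    have "form (y + z) (y + z) \<noteq> 0"
      using 3(1) z(3) by (simp add: form_add_self_char_2[OF two])
    moreover have "form x (y + z) \<noteq> 0" "\<forall>f\<in>F. form (y + z) f = 0"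
      using 3(2) y(2,3) z(2) by (simp_all add: form_add_left form_add_right)
    moreover have "y + z \<in> E"
      using E y(1) z(1) by (rule subspace_add)
    ultimately show ?thesis by blast
  qed
qed

text \<open>
  Finitely many vectors of \<open>B\<close> suffice for each vector of a countable spanning set, and no proper subset
  of the basis \<open>B\<close> spans.
\<close>

lemma countable_basis:
  assumes "countable_dimension smul" "is_basis smul B"
  shows "countable B"
proof -
  obtain C where C: "countable C" "span C = UNIV"
    using assms(1) unfolding countable_dimension_def is_basis_def by blast
  have B: "independent B" "span B = UNIV" using assms(2) unfolding is_basis_def by auto
  have "\<forall>c. \<exists>S. finite S \<and> S \<subseteq> B \<and> c \<in> span S"
  proof
    fix c
    have "c \<in> span B" using B(2) by simp
    then obtain S r where "finite S" "S \<subseteq> B" "c = (\<Sum>a\<in>S. r a *s a)"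
      unfolding span_explicit by blast
    then show "\<exists>S. finite S \<and> S \<subseteq> B \<and> c \<in> span S"
      by (intro exI[of _ S]) (simp add: span_sum span_scale span_base)
  qed
  then obtain S where S: "\<And>c. finite (S c)" "\<And>c. S c \<subseteq> B" "\<And>c. c \<in> span (S c)"
    by metis
  define D where "D = (\<Union>c\<in>C. S c)"
  have "countable D" unfolding D_def using C(1) S(1) by (simp add: countable_finite)
  moreover have "C \<subseteq> span D"
  proof
    fix c assume "c \<in> C"
    then show "c \<in> span D"
      using S(3)[of c] span_mono[of "S c" D] unfolding D_def by blast
  qed
  then have "span D = UNIV"
    using C(2) span_minimal[of C "span D"] by auto
  have "B \<subseteq> D"
  proof
    fix b assume b: "b \<in> B"
    show "b \<in> D"
    proof (rule ccontr)
      assume "b \<notin> D"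
      then have "D \<subseteq> B - {b}" using S(2) unfolding D_def by blast
      then have "b \<in> span (B - {b})" using \<open>span D = UNIV\<close> span_mono by blast
      then show False using B(1) b unfolding dependent_def by blast
    qed
  qed
  ultimately show ?thesis using countable_subset by blast
qed

end


section \<open>Forms represented by self-adjoint operators\<close>

locale nondegenerate_form = symmetric_form +
  assumes radical_0: "radical form = {0}"
begin

lemma zero_if_orthogonal:
  assumes "\<And>y. form x y = 0"
  shows "x = 0"
  using radical_0 assms unfolding radical_def by blast

lemma zero_if_orthogonal_to_spanning:
  assumes "span S = UNIV" "\<forall>s\<in>S. form x s = 0"
  shows "x = 0"
  using form_zero_on_span[OF assms(2)] assms(1) by (intro zero_if_orthogonal) auto

lemma orthogonal_frame_basis:
  assumes "is_basis smul B" "orthogonal_set form B"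
  shows "orthogonal_frame B"
  unfolding orthogonal_frame_def
proof (intro conjI ballI assms(2))
  fix v assume v: "v \<in> B"
  show "form v v \<noteq> 0"
  proof
    assume "form v v = 0"
    then have "\<forall>s\<in>B. form v s = 0"
      using assms(2) v unfolding orthogonal_set_def by auto
    then have "v = 0"
      using zero_if_orthogonal_to_spanning assms(1) unfolding is_basis_def by blast
    then show False
      using v assms(1) dependent_zero unfolding is_basis_def by blast
  qed
qed

text \<open>
  The functional is in fact represented by a combination of vectors of \<open>S\<close>. A kernel that makes the intersection smaller is dealt with by subtracting
  a multiple of its functional, chosen to vanish on a vector \<open>y\<close> witnessing that.
\<close>

lemma functional_represented:
  assumes "finite S" "Vector_Spaces.linear smul (*) \<phi>"
    and "\<And>y. \<forall>s\<in>S. form s y = 0 \<Longrightarrow> \<phi> y = 0"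
  shows "\<exists>v. \<forall>y. \<phi> y = form v y"
  using assms
proof (induction S arbitrary: \<phi> rule: finite_induct)
  case empty
  then show ?case by (intro exI[of _ 0]) simp
next
  case (insert s S)
  show ?case
  proof (cases "\<exists>y. form s y \<noteq> 0 \<and> (\<forall>t\<in>S. form t y = 0)")
    case False
    then show ?thesis using insert.IH[OF insert.prems(1)] insert.prems(2) by blast
  next
    case True
    then obtain y where y: "form s y \<noteq> 0" "\<forall>t\<in>S. form t y = 0" by blast
    define c where "c = \<phi> y / form s y"
    define \<psi> where "\<psi> = (\<lambda>x. \<phi> x - c * form s x)"
    have \<phi>: "\<phi> (u + v) = \<phi> u + \<phi> v" "\<phi> (a *s u) = a * \<phi> u" for u v a
      using insert.prems(1) by (simp_all add: Vector_Spaces.linear_iff)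
    have \<psi>: "Vector_Spaces.linear smul (*) \<psi>"
      using insert.prems(1)
      by (simp add: Vector_Spaces.linear_iff \<psi>_def form_bilinear algebra_simps)
    have "\<psi> x = 0" if x: "\<forall>t\<in>S. form t x = 0" for x
    proof -
      define r where "r = form s x / form s y"
      have "\<forall>t\<in>insert s S. form t (x - r *s y) = 0"
        using x y by (simp add: form_bilinear r_def)
      then have "\<phi> (x - r *s y) = 0" by (rule insert.prems(2))
      then have "\<phi> x = r * \<phi> y"
        using \<phi>(1)[of "x - r *s y" "r *s y"] \<phi>(2) by simp
      then show ?thesis by (simp add: \<psi>_def c_def r_def)
    qed
    then obtain v where v: "\<forall>x. \<psi> x = form v x"
      using insert.IH[OF \<psi>] by blast
    have "\<phi> x = form (v + c *s s) x" for x
      using spec[OF v, of x] by (simp add: \<psi>_def form_bilinear algebra_simps)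
    then show ?thesis by blast
  qed
qed

text \<open>
  Continuity into a discrete field says that the kernel of \<open>b x\<close> contains a basic neighborhood of
  \<open>0\<close>, that is, a finite intersection of kernels.
\<close>

lemma represented_by_operator:
  assumes b: "inner_product smul b"
    and cont: "partially_continuous (ip_topology smul form) (discrete_topology UNIV) b"
  obtains T where "Vector_Spaces.linear smul smul T" "\<forall>x y. b x y = form (T x) y"
proof -
  have lin: "Vector_Spaces.linear smul (*) (b x)" "Vector_Spaces.linear smul (*) (\<lambda>x. b x y)" for x y
    using b unfolding inner_product_def by blast+
  have "\<forall>x. \<exists>v. \<forall>y. b x y = form v y"
  proof
    fix x
    have "continuous_map (ip_topology smul form) (discrete_topology UNIV) (b x)"
      using cont unfolding partially_continuous_def by simp
    then have "openin (ip_topology smul form) {y. b x y \<in> {0}}"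
      using openin_continuous_map_preimage[of _ _ "b x" "{0}"] by fastforce
    moreover have b0: "b x 0 = 0"
    proof -
      have "b x (0 *s 0) = 0 * b x 0"
        using lin(1)[of x] unfolding Vector_Spaces.linear_iff by blast
      then show ?thesis by simp
    qed
    ultimately obtain S where S: "finite S" "basic_nhd smul form 0 S \<subseteq> {y. b x y \<in> {0}}"
      unfolding openin_ip_topology by blast
    have "b x y = 0" if "\<forall>s\<in>S. form s y = 0" for y
    proof -
      have "\<forall>s\<in>S. form y s = 0"
        using that form_sym by metis
      then have "\<forall>s\<in>S. \<forall>u\<in>span {s}. form y u = 0"
        by (auto simp: span_singleton form_scale_right)
      then have "y \<in> basic_nhd smul form 0 S"
        unfolding basic_nhd_def perp_def by auto
      then show ?thesis using S(2) by auto
    qed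
    then show "\<exists>v. \<forall>y. b x y = form v y"
      using functional_represented[OF S(1) lin(1)] by blast
  qed
  then obtain T where T: "\<forall>x y. b x y = form (T x) y" by metis
  have eqI: "u = v" if "\<And>y. form u y = form v y" for u v
    using zero_if_orthogonal[of "u - v"] that by (simp add: form_diff_left)
  have "T (x + y) = T x + T y" for x y
  proof (rule eqI)
    fix z
    have "b (x + y) z = b x z + b y z"
      using lin(2)[of z] unfolding Vector_Spaces.linear_iff by blast
    then show "form (T (x + y)) z = form (T x + T y) z"
      using T by (simp add: form_add_left)
  qed
  moreover have "T (c *s x) = c *s T x" for c x
  proof (rule eqI)
    fix z
    have "b (c *s x) z = c * b x z"
      using lin(2)[of z] unfolding Vector_Spaces.linear_iff by blast
    then show "form (T (c *s x)) z = form (c *s T x) z"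
      using T by (simp add: form_scale_left)
  qed
  ultimately have "Vector_Spaces.linear smul smul T"
    using vector_space_axioms by (simp add: Vector_Spaces.linear_iff)
  then show thesis using that T by blast
qed

lemma self_adjoint_if_represents:
  assumes "\<forall>x y. b x y = b y x" "\<forall>x y. b x y = form (T x) y"
  shows "self_adjoint form T"
  unfolding self_adjoint_def using assms by (metis form_sym)

text \<open>
  In an orthogonal basis, the coefficients of \<open>T v\<close> are up to non-zero factors the numbers
  \<open>\<langle>T v, w\<rangle>\<close>.
\<close>

lemma orthogonal_iff_diagonal:
  assumes B: "is_basis smul B" "orthogonal_set form B" and T: "\<forall>x y. b x y = form (T x) y"
  shows "orthogonal_set b B \<longleftrightarrow> diagonal_on smul B T"
proof
  assume "diagonal_on smul B T"
  show "orthogonal_set b B"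
    unfolding orthogonal_set_def
  proof (intro ballI impI)
    fix v w assume vw: "v \<in> B" "w \<in> B" "v \<noteq> w"
    then obtain c where "T v = c *s v"
      using \<open>diagonal_on smul B T\<close> unfolding diagonal_on_def span_singleton by blast
    then show "b v w = 0"
      using B(2) T vw unfolding orthogonal_set_def by (simp add: form_scale_left)
  qed
next
  assume orth: "orthogonal_set b B"
  have frame: "orthogonal_frame B" by (rule orthogonal_frame_basis[OF B])
  show "diagonal_on smul B T"
    unfolding diagonal_on_def
  proof
    fix v assume v: "v \<in> B"
    define c where "c = form (T v) v / form v v"
    have "\<forall>w\<in>B. form (T v - c *s v) w = 0"
    proof
      fix w assume w: "w \<in> B"
      show "form (T v - c *s v) w = 0"
      proof (cases "w = v")
        case True
        have "form v v \<noteq> 0" using frame v unfolding orthogonal_frame_def by blast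
        then show ?thesis using True by (simp add: form_bilinear c_def)
      next
        case False
        then have "form (T v) w = 0" "form v w = 0"
          using v w orth B(2) T unfolding orthogonal_set_def by metis+
        then show ?thesis by (simp add: form_bilinear)
      qed
    qed
    then have "T v - c *s v = 0"
      using zero_if_orthogonal_to_spanning B(1) unfolding is_basis_def by blast
    then show "T v \<in> span {v}"
      by (auto simp: span_singleton)
  qed
qed

text \<open>
  Over a nondegenerate form, an orthogonal family of subspaces that spans is automatically a
  direct sum: the component of \<open>x\<close> in \<open>W \<alpha>\<close> is determined by the inner products of \<open>x\<close> with \<open>W \<alpha>\<close>.
\<close>

lemma internal_direct_sum_orthogonal:
  assumes sub: "\<And>\<alpha>. \<alpha> \<in> A \<Longrightarrow> subspace (W \<alpha>)"
    and orth: "\<And>\<alpha> \<beta> x y. \<alpha> \<in> A \<Longrightarrow> \<beta> \<in> A \<Longrightarrow> \<alpha> \<noteq> \<beta> \<Longrightarrow> x \<in> W \<alpha> \<Longrightarrow> y \<in> W \<beta> \<Longrightarrow> form x y = 0"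
    and span: "span (\<Union>\<alpha>\<in>A. W \<alpha>) = UNIV"
  shows "internal_direct_sum smul A W"
proof -
  define dec where "dec x f \<longleftrightarrow> (\<forall>\<alpha>\<in>A. f \<alpha> \<in> W \<alpha>) \<and> (\<forall>\<alpha>. \<alpha> \<notin> A \<longrightarrow> f \<alpha> = 0) \<and>
      finite {\<alpha>. f \<alpha> \<noteq> 0} \<and> x = (\<Sum>\<alpha> | f \<alpha> \<noteq> 0. f \<alpha>)" for x f
  have ex: "\<exists>f. dec x f" for x
  proof -
    have "x \<in> span (\<Union>\<alpha>\<in>A. W \<alpha>)" using span by simp
    then show ?thesis
    proof (induction rule: span_induct_alt)
      case base
      show ?case
        using sub by (intro exI[of _ "\<lambda>_. 0"]) (simp add: dec_def subspace_0)
    next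
      case (step c u y)
      then obtain \<alpha> f where \<alpha>: "\<alpha> \<in> A" "u \<in> W \<alpha>" and f: "dec y f" by blast
      define g where "g = (\<lambda>\<beta>. f \<beta> + (if \<beta> = \<alpha> then c *s u else 0))"
      let ?S = "insert \<alpha> {\<beta>. f \<beta> \<noteq> 0}"
      have S: "finite ?S" "{\<beta>. g \<beta> \<noteq> 0} \<subseteq> ?S"
        using f by (auto simp: dec_def g_def)
      have "(\<Sum>\<beta> | g \<beta> \<noteq> 0. g \<beta>) = (\<Sum>\<beta>\<in>?S. g \<beta>)"
        using S by (intro sum.mono_neutral_left) auto
      also have "\<dots> = (\<Sum>\<beta>\<in>?S. f \<beta>) + c *s u"
        using S(1) by (simp add: g_def sum.distrib del: sum.insert)
      also have "(\<Sum>\<beta>\<in>?S. f \<beta>) = (\<Sum>\<beta> | f \<beta> \<noteq> 0. f \<beta>)"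
        using S(1) by (intro sum.mono_neutral_right) auto
      finally have "c *s u + y = (\<Sum>\<beta> | g \<beta> \<noteq> 0. g \<beta>)"
        using f by (simp add: dec_def add.commute)
      moreover have "\<forall>\<beta>\<in>A. g \<beta> \<in> W \<beta>"
        using f \<alpha> sub by (auto simp: dec_def g_def intro: subspace_add subspace_scale)
      moreover have "\<forall>\<beta>. \<beta> \<notin> A \<longrightarrow> g \<beta> = 0"
        using f \<alpha>(1) by (auto simp: dec_def g_def)
      ultimately show ?case
        using finite_subset[OF S(2,1)] unfolding dec_def by blast
    qed
  qed
  have component: "form (f \<alpha>) y = form x y" if f: "dec x f" and \<alpha>: "\<alpha> \<in> A" "y \<in> W \<alpha>" for x f \<alpha> y
  proof -
    have "form x y = (\<Sum>\<beta> | f \<beta> \<noteq> 0. form (f \<beta>) y)"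
      using f by (simp add: dec_def form_sum_left)
    also have "\<dots> = (\<Sum>\<beta> | f \<beta> \<noteq> 0. if \<beta> = \<alpha> then form (f \<alpha>) y else 0)"
    proof (rule sum.cong[OF refl])
      fix \<beta> assume "\<beta> \<in> {\<beta>. f \<beta> \<noteq> 0}"
      then have "\<beta> \<in> A" "f \<beta> \<in> W \<beta>" using f unfolding dec_def by blast+
      then show "form (f \<beta>) y = (if \<beta> = \<alpha> then form (f \<alpha>) y else 0)"
        using orth \<alpha> by auto
    qed
    also have "\<dots> = form (f \<alpha>) y"
      using f by (auto simp: dec_def)
    finally show ?thesis by simp
  qed
  have unique: "f = g" if f: "dec x f" and g: "dec x g" for x f g
  proof
    fix \<alpha>
    show "f \<alpha> = g \<alpha>"
    proof (cases "\<alpha> \<in> A")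
      case False
      then show ?thesis using f g unfolding dec_def by simp
    next
      case True
      have "\<forall>y\<in>(\<Union>\<beta>\<in>A. W \<beta>). form (f \<alpha> - g \<alpha>) y = 0"
      proof
        fix y assume "y \<in> (\<Union>\<beta>\<in>A. W \<beta>)"
        then obtain \<beta> where \<beta>: "\<beta> \<in> A" "y \<in> W \<beta>" by blast
        show "form (f \<alpha> - g \<alpha>) y = 0"
        proof (cases "\<beta> = \<alpha>")
          case True
          then show ?thesis
            using component[OF f] component[OF g] \<beta> by (simp add: form_diff_left)
        next
          case False
          have "f \<alpha> - g \<alpha> \<in> W \<alpha>"
            using f g \<open>\<alpha> \<in> A\<close> sub unfolding dec_def by (blast intro: subspace_diff)
          then show ?thesis using orth[of \<alpha> \<beta>] \<beta> False \<open>\<alpha> \<in> A\<close> by blast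
        qed
      qed
      then have "f \<alpha> - g \<alpha> = 0" by (rule zero_if_orthogonal_to_spanning[OF span])
      then show ?thesis by simp
    qed
  qed
  have "\<exists>!f. dec x f" for x
    using ex unique by blast
  then show ?thesis
    using sub unfolding internal_direct_sum_def dec_def by blast
qed

end


section \<open>Root spaces of self-adjoint families\<close>

locale self_adjoint_family = nondegenerate_form +
  fixes \<T> :: "('b \<Rightarrow> 'b) set"
  assumes linear_family: "T \<in> \<T> \<Longrightarrow> Vector_Spaces.linear smul smul T"
    and self_adjoint_family: "T \<in> \<T> \<Longrightarrow> self_adjoint form T"
    and diagonalizable: "simultaneously_diagonalizable smul \<T>"
begin

abbreviation "V \<equiv> root_space smul \<T>"

lemma root_spaceD: "x \<in> V \<alpha> \<Longrightarrow> T \<in> \<T> \<Longrightarrow> T x = \<alpha> T *s x"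
  unfolding root_space_def by blast

lemma subspace_root_space: "subspace (V \<alpha>)"
proof (rule subspaceI)
  show "0 \<in> V \<alpha>"
  proof -
    have "T 0 = 0" if "T \<in> \<T>" for T
    proof -
      have "T (0 *s 0) = 0 *s T 0"
        using linear_family[OF that] unfolding Vector_Spaces.linear_iff by blast
      then show ?thesis by simp
    qed
    then show ?thesis by (simp add: root_space_def)
  qed
next
  fix x y assume "x \<in> V \<alpha>" "y \<in> V \<alpha>"
  then show "x + y \<in> V \<alpha>"
    using linear_family
    by (simp add: root_space_def Vector_Spaces.linear_iff scale_right_distrib)
next
  fix c x assume x: "x \<in> V \<alpha>"
  have "T (c *s x) = \<alpha> T *s c *s x" if "T \<in> \<T>" for T
  proof -
    have "T (c *s x) = c *s T x"
      using linear_family[OF that] unfolding Vector_Spaces.linear_iff by blast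
    then show ?thesis using root_spaceD[OF x that] by (metis scale_left_commute)
  qed
  then show "c *s x \<in> V \<alpha>" unfolding root_space_def by blast
qed

text \<open>Eigenvectors of a self-adjoint operator for distinct eigenvalues are orthogonal.\<close>

lemma root_spaces_orthogonal:
  assumes "\<alpha> \<in> roots smul \<T>" "\<beta> \<in> roots smul \<T>" "\<alpha> \<noteq> \<beta>" "x \<in> V \<alpha>" "y \<in> V \<beta>"
  shows "form x y = 0"
proof -
  obtain T where T: "T \<in> \<T>" "\<alpha> T \<noteq> \<beta> T"
    using assms(1-3) extensionalityI[of \<alpha> \<T> \<beta>] unfolding roots_def by blast
  have "\<alpha> T * form x y = form (T x) y"
    using root_spaceD[OF assms(4) T(1)] by (simp add: form_scale_left)
  also have "\<dots> = form x (T y)"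
    using self_adjoint_family[OF T(1)] unfolding self_adjoint_def by blast
  also have "\<dots> = \<beta> T * form x y"
    using root_spaceD[OF assms(5) T(1)] by (simp add: form_scale_right)
  finally show ?thesis using T(2) by simp
qed

definition eigenbasis :: "'b set" where
  "eigenbasis = (SOME B. is_basis smul B \<and> (\<forall>T\<in>\<T>. diagonal_on smul B T))"

lemma eigenbasis: "is_basis smul eigenbasis" "T \<in> \<T> \<Longrightarrow> diagonal_on smul eigenbasis T"
  using someI_ex[OF diagonalizable[unfolded simultaneously_diagonalizable_def]]
  unfolding eigenbasis_def by blast+

lemma span_eigenbasis: "span eigenbasis = UNIV"
  using eigenbasis(1) unfolding is_basis_def by blast

lemma eigenbasis_root:
  assumes "b \<in> eigenbasis"
  obtains \<alpha> where "\<alpha> \<in> roots smul \<T>" "b \<in> V \<alpha>"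
proof -
  have "b \<noteq> 0"
    using assms eigenbasis(1) dependent_zero unfolding is_basis_def by blast
  have "\<forall>T\<in>\<T>. \<exists>c. T b = c *s b"
    using eigenbasis(2) assms unfolding diagonal_on_def span_singleton by blast
  then obtain c where c: "\<forall>T\<in>\<T>. T b = c T *s b" by metis
  show thesis
  proof
    show "restrict c \<T> \<in> roots smul \<T>"
      using c \<open>b \<noteq> 0\<close> unfolding roots_def by auto
    show "b \<in> V (restrict c \<T>)"
      using c by (simp add: root_space_def)
  qed
qed

lemma span_root_spaces: "span (\<Union>\<alpha>\<in>roots smul \<T>. V \<alpha>) = UNIV"
proof -
  have "eigenbasis \<subseteq> (\<Union>\<alpha>\<in>roots smul \<T>. V \<alpha>)"
    using eigenbasis_root by blast
  then show ?thesis using span_mono span_eigenbasis by blast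
qed

lemma direct_sum_root_spaces: "internal_direct_sum smul (roots smul \<T>) V"
  by (intro internal_direct_sum_orthogonal subspace_root_space span_root_spaces)
    (rule root_spaces_orthogonal)

lemma nondegenerate_root_space:
  assumes "\<alpha> \<in> roots smul \<T>"
  shows "nondegenerate_on (V \<alpha>)"
  unfolding nondegenerate_on_def
proof (intro ballI impI)
  fix x assume x: "x \<in> V \<alpha>" "\<forall>y\<in>V \<alpha>. form x y = 0"
  have "\<forall>y\<in>(\<Union>\<beta>\<in>roots smul \<T>. V \<beta>). form x y = 0"
    using x root_spaces_orthogonal[OF assms] by blast
  then show "x = 0" by (rule zero_if_orthogonal_to_spanning[OF span_root_spaces])
qed

text \<open>
  A vector orthogonal to all other root spaces is an eigenvector: for an eigenvector \<open>y\<close> with root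
  \<open>\<beta>\<close> one has \<open>\<langle>T x - \<alpha>(T) x, y\<rangle> = (\<beta>(T) - \<alpha>(T)) \<langle>x, y\<rangle>\<close>, and one of the factors is zero.
\<close>

lemma root_space_perp_closed:
  assumes "\<alpha> \<in> roots smul \<T>"
  shows "perp form (perp form (V \<alpha>)) \<subseteq> V \<alpha>"
proof
  fix x assume x: "x \<in> perp form (perp form (V \<alpha>))"
  show "x \<in> V \<alpha>"
    unfolding root_space_def
  proof (intro CollectI ballI)
    fix T assume T: "T \<in> \<T>"
    have "\<forall>y\<in>(\<Union>\<beta>\<in>roots smul \<T>. V \<beta>). form (T x - \<alpha> T *s x) y = 0"
    proof
      fix y assume "y \<in> (\<Union>\<beta>\<in>roots smul \<T>. V \<beta>)"
      then obtain \<beta> where \<beta>: "\<beta> \<in> roots smul \<T>" "y \<in> V \<beta>" by blast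
      have "form (T x) y = form x (T y)"
        using self_adjoint_family[OF T] unfolding self_adjoint_def by blast
      then have eq: "form (T x - \<alpha> T *s x) y = (\<beta> T - \<alpha> T) * form x y"
        using root_spaceD[OF \<beta>(2) T] by (simp add: form_bilinear algebra_simps)
      show "form (T x - \<alpha> T *s x) y = 0"
      proof (cases "\<beta> = \<alpha>")
        case False
        then have "y \<in> perp form (V \<alpha>)"
          using root_spaces_orthogonal[OF \<beta>(1) assms] \<beta>(2) unfolding perp_def by blast
        then have "form x y = 0" using x unfolding perp_def by blast
        then show ?thesis using eq by simp
      qed (simp add: eq)
    qed
    then have "T x - \<alpha> T *s x = 0" by (rule zero_if_orthogonal_to_spanning[OF span_root_spaces])
    then show "T x = \<alpha> T *s x" by simp
  qed
qed

text \<open>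
  The part of \<open>x \<in> V \<alpha>\<close> that comes from basis vectors outside \<open>V \<alpha>\<close> lies in \<open>V \<alpha>\<close> and is
  orthogonal to it, so it is zero.
\<close>

lemma root_space_spanned_by_eigenbasis:
  assumes "\<alpha> \<in> roots smul \<T>"
  shows "V \<alpha> \<subseteq> span (eigenbasis \<inter> V \<alpha>)"
proof
  fix x assume x: "x \<in> V \<alpha>"
  have "(eigenbasis \<inter> V \<alpha>) \<union> (eigenbasis - V \<alpha>) = eigenbasis" by blast
  then have "x \<in> span ((eigenbasis \<inter> V \<alpha>) \<union> (eigenbasis - V \<alpha>))"
    using span_eigenbasis by simp
  then obtain u w where uw: "x = u + w" "u \<in> span (eigenbasis \<inter> V \<alpha>)" "w \<in> span (eigenbasis - V \<alpha>)"
    unfolding span_Un by blast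
  have "u \<in> V \<alpha>"
    using uw(2) span_minimal[OF Int_lower2 subspace_root_space] by blast
  then have "x - u \<in> V \<alpha>" using x subspace_root_space subspace_diff by blast
  then have w: "w \<in> V \<alpha>" using uw(1) by simp
  have "form w y = 0" if y: "y \<in> V \<alpha>" for y
  proof -
    have "\<forall>b\<in>eigenbasis - V \<alpha>. form y b = 0"
    proof
      fix b assume b: "b \<in> eigenbasis - V \<alpha>"
      then obtain \<beta> where "\<beta> \<in> roots smul \<T>" "b \<in> V \<beta>" using eigenbasis_root by blast
      then show "form y b = 0"
        using root_spaces_orthogonal[OF assms _ _ y] b by blast
    qed
    then show ?thesis using form_zero_on_span uw(3) form_sym by metis
  qed
  then have "w = 0"
    using nondegenerate_root_space[OF assms] w unfolding nondegenerate_on_def by blast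
  then show "x \<in> span (eigenbasis \<inter> V \<alpha>)" using uw by simp
qed

text \<open>
  Orthogonal bases of the single root spaces can be united, since distinct root spaces are orthogonal.
\<close>

lemma orthogonal_eigenbasis:
  assumes "\<And>\<alpha>. \<alpha> \<in> roots smul \<T> \<Longrightarrow>
    \<exists>B. B \<subseteq> V \<alpha> \<and> orthogonal_frame B \<and> V \<alpha> \<subseteq> span B"
  shows "\<exists>B. is_basis smul B \<and> orthogonal_set form B \<and> (\<forall>T\<in>\<T>. diagonal_on smul B T)"
proof -
  obtain B where B: "\<And>\<alpha>. \<alpha> \<in> roots smul \<T> \<Longrightarrow>
      B \<alpha> \<subseteq> V \<alpha> \<and> orthogonal_frame (B \<alpha>) \<and> V \<alpha> \<subseteq> span (B \<alpha>)"
    using assms by metis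
  define U where "U = (\<Union>\<alpha>\<in>roots smul \<T>. B \<alpha>)"
  have orth: "orthogonal_set form U"
    unfolding orthogonal_set_def
  proof (intro ballI impI)
    fix v w assume "v \<in> U" "w \<in> U" "v \<noteq> w"
    then obtain \<alpha> \<beta> where *: "\<alpha> \<in> roots smul \<T>" "v \<in> B \<alpha>" "\<beta> \<in> roots smul \<T>" "w \<in> B \<beta>"
      unfolding U_def by blast
    show "form v w = 0"
    proof (cases "\<alpha> = \<beta>")
      case True
      then show ?thesis
        using B[OF *(1)] * \<open>v \<noteq> w\<close> unfolding orthogonal_frame_def orthogonal_set_def by blast
    next
      case False
      then show ?thesis using root_spaces_orthogonal B * by blast
    qed
  qed
  then have "orthogonal_frame U"
    using B unfolding orthogonal_frame_def U_def by blast
  then have "independent U" by (rule independent_orthogonal_frame)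
  moreover have "(\<Union>\<alpha>\<in>roots smul \<T>. V \<alpha>) \<subseteq> span U"
  proof
    fix x assume "x \<in> (\<Union>\<alpha>\<in>roots smul \<T>. V \<alpha>)"
    then obtain \<alpha> where \<alpha>: "\<alpha> \<in> roots smul \<T>" "x \<in> V \<alpha>" by blast
    then have "B \<alpha> \<subseteq> U" unfolding U_def by blast
    then show "x \<in> span U" using B[OF \<alpha>(1)] \<alpha>(2) span_mono by blast
  qed
  then have "span U = UNIV"
    using span_root_spaces span_minimal[of "\<Union>\<alpha>\<in>roots smul \<T>. V \<alpha>" "span U"] by auto
  moreover have "diagonal_on smul U T" if T: "T \<in> \<T>" for T
    unfolding diagonal_on_def
  proof
    fix v assume "v \<in> U"
    then obtain \<alpha> where "v \<in> V \<alpha>" using B unfolding U_def by blast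
    then have "T v = \<alpha> T *s v" using T by (rule root_spaceD)
    then show "T v \<in> span {v}" by (auto simp: span_singleton)
  qed
  ultimately show ?thesis using orth unfolding is_basis_def by blast
qed

lemma countable_eigenbasis_root_space:
  assumes "countable_dimension smul"
  shows "countable (eigenbasis \<inter> V \<alpha>)"
  using countable_basis[OF assms eigenbasis(1)] by (simp add: countable_Int1)

lemma orthogonal_eigenbasis_char_not_2:
  assumes "(2::'a) \<noteq> 0" "countable_dimension smul"
  shows "\<exists>B. is_basis smul B \<and> orthogonal_set form B \<and> (\<forall>T\<in>\<T>. diagonal_on smul B T)"
proof (rule orthogonal_eigenbasis)
  fix \<alpha> assume \<alpha>: "\<alpha> \<in> roots smul \<T>"
  show "\<exists>B. B \<subseteq> V \<alpha> \<and> orthogonal_frame B \<and> V \<alpha> \<subseteq> span B"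
    by (rule orthogonal_basis_char_not_2[OF assms(1) nondegenerate_root_space[OF \<alpha>]
          subspace_root_space countable_eigenbasis_root_space[OF assms(2)] Int_lower2
          root_space_spanned_by_eigenbasis[OF \<alpha>]])
qed

lemma orthogonal_eigenbasis_char_2:
  assumes "(2::'a) = 0" "countable_dimension smul"
    and "\<forall>\<alpha>\<in>roots smul \<T>. \<not> perp_closed form (isotropic_part form (V \<alpha>)) \<or>
       \<not> quotient_finite_dimensional smul (V \<alpha>) (isotropic_part form (V \<alpha>))"
  shows "\<exists>B. is_basis smul B \<and> orthogonal_set form B \<and> (\<forall>T\<in>\<T>. diagonal_on smul B T)"
proof (rule orthogonal_eigenbasis)
  fix \<alpha> assume \<alpha>: "\<alpha> \<in> roots smul \<T>"
  show "\<exists>B. B \<subseteq> V \<alpha> \<and> orthogonal_frame B \<and> V \<alpha> \<subseteq> span B"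
    by (rule orthogonal_basis_char_2[OF assms(1) nondegenerate_root_space[OF \<alpha>]
          subspace_root_space countable_eigenbasis_root_space[OF assms(2)] Int_lower2
          root_space_spanned_by_eigenbasis[OF \<alpha>] root_space_perp_closed[OF \<alpha>] bspec[OF assms(3) \<alpha>]])
qed

end


section \<open>Simultaneous orthogonalization\<close>

lemma two_eq_0_iff_CHAR: "(2::'k::field) = 0 \<longleftrightarrow> CHAR('k) = 2"
proof -
  have "(2::'k) = 0 \<longleftrightarrow> CHAR('k) dvd 2"
    using of_nat_eq_0_iff_char_dvd[of 2, where 'a = 'k] by simp
  moreover have "CHAR('k) \<noteq> 1"
    using of_nat_eq_0_iff_char_dvd[of 1, where 'a = 'k] by auto
  moreover have "CHAR('k) = 0 \<or> CHAR('k) = 1 \<or> CHAR('k) = 2" if "CHAR('k) dvd 2"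
    using dvd_imp_le[OF that] by linarith
  ultimately show ?thesis by auto
qed

theorem theorem1:
  fixes smul :: "'k::field \<Rightarrow> 'v::ab_group_add \<Rightarrow> 'v"
    and ip :: "'i \<Rightarrow> 'v \<Rightarrow> 'v \<Rightarrow> 'k"
    and I :: "'i set" and i0 :: 'i
  assumes "vector_space smul"
    and "nondegenerate_family_at smul (ip i0) (ip ` insert i0 I)"
  shows
    "(\<forall>i\<in>I. \<exists>T. Vector_Spaces.linear smul smul T \<and> (\<forall>x y. ip i x y = ip i0 (T x) y)) \<and>
     (\<forall>T :: 'i \<Rightarrow> 'v \<Rightarrow> 'v.
        (\<forall>i\<in>I. Vector_Spaces.linear smul smul (T i) \<and> (\<forall>x y. ip i x y = ip i0 (T i x) y)) \<longrightarrow>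
        (\<forall>i\<in>I. self_adjoint (ip i0) (T i)) \<and>
        (simultaneously_orthogonalizable smul (ip ` insert i0 I) \<longleftrightarrow>
           (\<exists>B. is_basis smul B \<and> orthogonal_set (ip i0) B \<and> (\<forall>i\<in>I. diagonal_on smul B (T i)))) \<and>
        (CHAR('k) \<noteq> 2 \<and> countable_dimension smul \<longrightarrow>
           (simultaneously_orthogonalizable smul (ip ` insert i0 I) \<longleftrightarrow>
            simultaneously_diagonalizable smul (T ` I))) \<and>
        (CHAR('k) = 2 \<and> countable_dimension smul \<longrightarrow>
           (simultaneously_orthogonalizable smul (ip ` insert i0 I) \<longrightarrow>
              simultaneously_diagonalizable smul (T ` I)) \<and>
           (simultaneously_diagonalizable smul (T ` I) \<longrightarrow>
              internal_direct_sum smul (roots smul (T ` I)) (root_space smul (T ` I)) \<and>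
              ((\<forall>\<alpha>\<in>roots smul (T ` I).
                  \<not> perp_closed (ip i0) (isotropic_part (ip i0) (root_space smul (T ` I) \<alpha>)) \<or>
                  \<not> quotient_finite_dimensional smul (root_space smul (T ` I) \<alpha>)
                      (isotropic_part (ip i0) (root_space smul (T ` I) \<alpha>))) \<longrightarrow>
               simultaneously_orthogonalizable smul (ip ` insert i0 I)))))"
proof -
  let ?SO = "simultaneously_orthogonalizable smul (ip ` insert i0 I)"
  let ?repr = "\<lambda>T. \<forall>i\<in>I. Vector_Spaces.linear smul smul (T i) \<and> (\<forall>x y. ip i x y = ip i0 (T i x) y)"
  let ?SD = "\<lambda>T. simultaneously_diagonalizable smul (T ` I)"
  have "inner_product smul (ip i0)" "radical (ip i0) = {0}"
    using assms(2) unfolding nondegenerate_family_at_def by blast+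
  with assms(1) interpret nondegenerate_form smul "ip i0"
    by (intro nondegenerate_form.intro symmetric_form.intro symmetric_form_axioms.intro
        nondegenerate_form_axioms.intro)
  have fam: "inner_product smul (ip i)"
      "partially_continuous (ip_topology smul (ip i0)) (discrete_topology UNIV) (ip i)" if "i \<in> I" for i
  proof -
    have "ip i \<in> ip ` insert i0 I" using that by blast
    then show "inner_product smul (ip i)"
      "partially_continuous (ip_topology smul (ip i0)) (discrete_topology UNIV) (ip i)"
      using assms(2) unfolding nondegenerate_family_at_def by blast+
  qed
  have ex: "\<exists>T. Vector_Spaces.linear smul smul T \<and> (\<forall>x y. ip i x y = ip i0 (T x) y)"
    if "i \<in> I" for i
    by (rule represented_by_operator[OF fam[OF that]]) blast
  have adj: "self_adjoint (ip i0) (T i)" if T: "?repr T" and i: "i \<in> I" for T i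
  proof (rule self_adjoint_if_represents)
    show "\<forall>x y. ip i x y = ip i y x"
      using fam(1)[OF i] unfolding inner_product_def by blast
    show "\<forall>x y. ip i x y = ip i0 (T i x) y" using T i by blast
  qed
  have SO_iff: "?SO \<longleftrightarrow>
      (\<exists>B. is_basis smul B \<and> orthogonal_set (ip i0) B \<and> (\<forall>i\<in>I. diagonal_on smul B (T i)))"
    if T: "?repr T" for T
  proof -
    have "orthogonal_set (ip i) B \<longleftrightarrow> diagonal_on smul B (T i)"
      if "is_basis smul B" "orthogonal_set (ip i0) B" "i \<in> I" for i B
      using orthogonal_iff_diagonal[OF that(1,2)] T that(3) by blast
    then show ?thesis
      unfolding simultaneously_orthogonalizable_def by (intro iff_exI) auto
  qed
  have SD: "?SD T" if "?repr T" ?SO for T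
    using that(2) unfolding SO_iff[OF that(1)] simultaneously_diagonalizable_def by blast
  have family: "self_adjoint_family smul (ip i0) (T ` I)" if T: "?repr T" and "?SD T" for T
    using T adj[OF T] that(2)
    by (intro self_adjoint_family.intro nondegenerate_form_axioms
        self_adjoint_family_axioms.intro) blast+
  have SO: ?SO
    if T: "?repr T" and B: "\<exists>B. is_basis smul B \<and> orthogonal_set (ip i0) B \<and>
        (\<forall>S\<in>T ` I. diagonal_on smul B S)" for T
    using B unfolding SO_iff[OF T] by blast
  show ?thesis
  proof (intro conjI allI impI)
    show "\<forall>i\<in>I. \<exists>T. Vector_Spaces.linear smul smul T \<and> (\<forall>x y. ip i x y = ip i0 (T x) y)"
      using ex by blast
  next
    fix T :: "'i \<Rightarrow> 'v \<Rightarrow> 'v"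
    assume T: "?repr T"
    show "\<forall>i\<in>I. self_adjoint (ip i0) (T i)"
      using adj[OF T] by blast
    show "?SO \<longleftrightarrow>
        (\<exists>B. is_basis smul B \<and> orthogonal_set (ip i0) B \<and> (\<forall>i\<in>I. diagonal_on smul B (T i)))"
      by (rule SO_iff[OF T])
    show "?SO \<longleftrightarrow> ?SD T" if char: "CHAR('k) \<noteq> 2 \<and> countable_dimension smul"
    proof
      assume sd: "?SD T"
      have "(2::'k) \<noteq> 0" "countable_dimension smul"
        using char two_eq_0_iff_CHAR[where 'k = 'k] by blast+
      then show ?SO
        by (rule SO[OF T self_adjoint_family.orthogonal_eigenbasis_char_not_2[OF family[OF T sd]]])
    qed (rule SD[OF T])
    show "?SD T" if ?SO
      using that by (rule SD[OF T])
    show "internal_direct_sum smul (roots smul (T ` I)) (root_space smul (T ` I))" if "?SD T"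
      by (rule self_adjoint_family.direct_sum_root_spaces[OF family[OF T that]])
    show ?SO if char: "CHAR('k) = 2 \<and> countable_dimension smul" and sd: "?SD T"
      and big: "\<forall>\<alpha>\<in>roots smul (T ` I).
          \<not> perp_closed (ip i0) (isotropic_part (ip i0) (root_space smul (T ` I) \<alpha>)) \<or>
          \<not> quotient_finite_dimensional smul (root_space smul (T ` I) \<alpha>)
              (isotropic_part (ip i0) (root_space smul (T ` I) \<alpha>))"
    proof -
      have "(2::'k) = 0" "countable_dimension smul"
        using char two_eq_0_iff_CHAR[where 'k = 'k] by blast+
      then show ?thesis
        using big
        by (rule SO[OF T self_adjoint_family.orthogonal_eigenbasis_char_2[OF family[OF T sd]]])
    qed
  qed
qed

end
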